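(* Let $m\ge n$, let $A\in\mathbb{R}^{m\times n}$ have rows $a_1^T,\dots,a_m^T$ and $V\in\mathbb{R}^{m\times n}$ have rows $v_1^T,\dots,v_m^T$, with $\langle a_i,v_i\rangle>0$ for all $i$. Let $p_1,\dots,p_m>0$ with $\sum_i p_i=1$, let $b\in\mathbb{R}^m$, and let $\hat x\in\mathbb{R}^n$ satisfy $A\hat x=b$. Put $D=\operatorname{Diag}\big(\tfrac{p_i}{\langle a_i,v_i\rangle}\big)$ and $S=\operatorname{Diag}\big(\tfrac{\|v_i\|^2}{\langle a_i,v_i\rangle}\big)$. Let $(x_k)_{k\ge0}$ be the iterates of the randomized Kaczmarz method with mismatched adjoint (defined in the context) started at a deterministic $x_0\in\mathbb{R}^n$. (1) If $\rho(I-V^TDA)<1$, then $\mathbb{E}(x_k-\hat x)\to 0$ as $k\to\infty$; moreover, for all $k\ge 0$, $$\|\mathbb{E}(x_k-\hat x)\|\le \|I-V^TDA\|^k\,\|x_0-\hat x\|.$$ (2) If $\lambda:=\lambda_{\min}\big(V^TDA+A^TDV-A^TSDA\big)>0$, then for all $k\ge0$ $$\mathbb{E}\big[\|x_{k+1}-\hat x\|^2\big]\le(1-\lambda)\,\mathbb{E}\big[\|x_k-\hat x\|^2\big].$$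
   Context: The randomized Kaczmarz method with mismatched adjoint for $Ax=b$: given $x_0$, at each step $k=0,1,2,\dots$ choose an index $i_k\in\{1,\dots,m\}$ at random, independently of the previous choices, with $\Pr(i_k=i)=p_i$, and set $$x_{k+1}=x_k-\frac{\langle a_{i_k},x_k\rangle-b_{i_k}}{\langle a_{i_k},v_{i_k}\rangle}\,v_{i_k}.$$ Expectations are over all random indices. $\langle\cdot,\cdot\rangle$ and $\|\cdot\|$ on vectors are the Euclidean inner product and norm; $\|\cdot\|$ on matrices is the spectral norm. $\rho(M)$ is the spectral radius (largest absolute value of the complex eigenvalues) of a real square matrix $M$; $\lambda_{\min}(M)$ is the smallest eigenvalue of a real symmetric matrix $M$. $\operatorname{Diag}(d_i)$ is the diagonal matrix with entries $d_1,\dots,d_m$. *)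

theory Defs
  imports "HOL-Probability.Probability"
begin

definition diag_matrix :: "('m::finite \<Rightarrow> 'a::zero) \<Rightarrow> 'a ^ 'm ^ 'm" where
  "diag_matrix d = (\<chi> i j. if i = j then d i else 0)"

definition is_eigenvalue :: "'a::field ^ 'n::finite ^ 'n \<Rightarrow> 'a \<Rightarrow> bool" where
  "is_eigenvalue M c \<longleftrightarrow> (\<exists>v. v \<noteq> 0 \<and> M *v v = c *s v)"

text \<open>Every square matrix over a field has finitely many eigenvalues, and at least one if the
  field is \<^typ>\<open>complex\<close>; so the maximum below is taken over a finite nonempty set.\<close>

definition spec_rad :: "real ^ 'n::finite ^ 'n \<Rightarrow> real" where
  "spec_rad M = Max {cmod c | c. is_eigenvalue (\<chi> i j. complex_of_real (M $ i $ j)) c}"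

text \<open>Meaningful for symmetric matrices, whose set of real eigenvalues is finite and nonempty
  (and which have no others).\<close>

definition lambda_min :: "real ^ 'n::finite ^ 'n \<Rightarrow> real" where
  "lambda_min M = Min {c. is_eigenvalue M c}"

text \<open>The iterates for a given sequence of indices \<open>idx\<close>.  Note that \<open>A $ i\<close> is the \<open>i\<close>-th row of
  \<open>A\<close>, as a vector.\<close>

primrec rkma ::
  "real ^ 'n::finite ^ 'm::finite \<Rightarrow> real ^ 'n ^ 'm \<Rightarrow> real ^ 'm \<Rightarrow> real ^ 'n
    \<Rightarrow> (nat \<Rightarrow> 'm) \<Rightarrow> nat \<Rightarrow> real ^ 'n" where
  "rkma A V b x0 idx 0 = x0"
| "rkma A V b x0 idx (Suc k) =
     rkma A V b x0 idx k
     - ((A $ idx k \<bullet> rkma A V b x0 idx k - b $ idx k) / (A $ idx k \<bullet> V $ idx k)) *\<^sub>R V $ idx k"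

end

(* The error e_k = x_k - xhat satisfies e_{k+1} = P_i e_k, P_i linear, with i = i_k independent of e_k, so
   conditional on e_k its mean is (I - V^T D A) e_k and its mean square is |e_k|^2 - <e_k, W e_k>,
   where W is the matrix in (2).  Part (2) follows because the minimum of <y, W y> on the unit
   sphere is attained at an eigenvector of W.  For part (1), let T have all its eigenvalues in the
   open unit disc and let p(T) v = 0.  Induction on deg p shows T^k v -> 0: split off a root c of p
   and put w = T v - c v, so T^k w -> 0.  If |c| < 1, the recursion T^{k+1} v = c T^k v + T^k w
   gives T^k v -> 0; otherwise T - c is invertible and T^k v = (T - c)^{-1} T^k w. *)
theory Submission
  imports Defs "HOL-Computational_Algebra.Fundamental_Theorem_Algebra"
begin

section \<open>Eigenvectors and finiteness of the set of eigenvalues\<close>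

lemma mat_mult_vector: "(mat c :: 'a::semiring_1 ^ 'n::finite ^ 'n) *v y = c *s y"
  by (simp add: vec_eq_iff matrix_vector_mult_def mat_def if_distrib[of "\<lambda>a. a * b" for b]
      cong: if_cong)

text \<open>Each eigenvalue \<open>c\<close> is its own index. Applying \<open>M\<close> to a
  relation and subtracting \<open>d\<close> times that relation cancels the \<open>f d\<close> term
  and leaves coefficients \<open>u c * (c - d)\<close>. Their vanishing for \<open>c\<close> in
  \<open>C\<close> forces \<open>u c = 0\<close>, because \<open>d\<close> is not in
  \<open>C\<close>.\<close>

lemma eigenvectors_independent:
  fixes M :: "'a::field ^ 'n::finite ^ 'n"
  assumes "finite C" "\<And>c. c \<in> C \<Longrightarrow> f c \<noteq> 0 \<and> M *v f c = c *s f c"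
    and "(\<Sum>c\<in>C. u c *s f c) = 0" and "c \<in> C"
  shows "u c = 0"
  using assms
proof (induction C arbitrary: u c rule: finite_induct)
  case empty
  then show ?case by simp
next
  case (insert d C)
  have s: "u d *s f d + (\<Sum>c\<in>C. u c *s f c) = 0"
    using insert by simp
  have "M *v (u d *s f d + (\<Sum>c\<in>C. u c *s f c)) = (u d * d) *s f d + (\<Sum>c\<in>C. (u c * c) *s f c)"
    using insert.prems(1)
    by (simp add: vec.add vec.sum vec.scale matrix_vector_right_distrib)
  then have "(u d * d) *s f d + (\<Sum>c\<in>C. (u c * c) *s f c) = 0"
    by (simp add: s)
  moreover have "(u d * d) *s f d + (\<Sum>c\<in>C. (d * u c) *s f c) = 0"
    using arg_cong[OF s, of "\<lambda>v. d *s v"]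
    by (simp add: vec.scale_sum_right vec.scale_right_distrib mult.commute)
  ultimately have "(\<Sum>c\<in>C. (u c * c) *s f c) = (\<Sum>c\<in>C. (d * u c) *s f c)"
    by (metis add_left_cancel)
  then have "(\<Sum>c\<in>C. (u c * (c - d)) *s f c) = 0"
    by (simp add: algebra_simps vec.scale_left_diff_distrib sum_subtractf)
  then have "\<And>c. c \<in> C \<Longrightarrow> u c * (c - d) = 0"
    using insert.IH[of "\<lambda>c. u c * (c - d)"] insert.prems(1) by blast
  then have u0: "\<And>c. c \<in> C \<Longrightarrow> u c = 0"
    using insert.hyps(2) by fastforce
  then have "u d *s f d = 0"
    using s by simp
  then have "u d = 0"
    using insert.prems(1)[of d] by (simp add: vec.scale_eq_0_iff)
  then show ?case
    using u0 insert.prems(3) by auto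
qed

text \<open>One eigenvector per eigenvalue gives an independent family, so no finite set of
  eigenvalues exceeds the dimension. Finiteness is what makes \<open>Max\<close> in
  \<open>spec_rad\<close> and \<open>Min\<close> in \<open>lambda_min\<close> bound every
  eigenvalue.\<close>

lemma finite_eigenvalues:
  fixes M :: "'a::field ^ 'n::finite ^ 'n"
  shows "finite {c. is_eigenvalue M c}"
proof -
  define f where "f c = (SOME v. v \<noteq> 0 \<and> M *v v = c *s v)" for c
  have f: "f c \<noteq> 0 \<and> M *v f c = c *s f c" if "is_eigenvalue M c" for c
    using that unfolding is_eigenvalue_def f_def by (rule someI_ex)
  have "card C \<le> CARD('n)" if C: "C \<subseteq> {c. is_eigenvalue M c}" "finite C" for C
  proof -
    have inj: "inj_on f C"
    proof (rule inj_onI)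
      fix c d assume "c \<in> C" "d \<in> C" "f c = f d"
      then have "c *s f c = d *s f c" "f c \<noteq> 0"
        using f C(1) by (metis mem_Collect_eq subsetD)+
      then show "c = d" by simp
    qed
    have "vec.independent (f ` C)"
    proof (subst vec.independent_explicit, intro conjI allI impI)
      show "finite (f ` C)" using C by simp
      fix g assume "(\<Sum>v\<in>f ` C. g v *s v) = 0"
      then have "(\<Sum>c\<in>C. g (f c) *s f c) = 0"
        by (simp add: sum.reindex[OF inj])
      then show "\<forall>v\<in>f ` C. g v = 0"
        using eigenvectors_independent[OF C(2), of f M "\<lambda>c. g (f c)"] f C(1) by blast
    qed
    then have "card (f ` C) \<le> CARD('n)"
      using vec.independent_bound_general[of "f ` C"] dim_subset_UNIV_cart_gen[of "f ` C"] by linarith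
    then show ?thesis
      by (simp add: card_image[OF inj])
  qed
  then show ?thesis
    using finite_if_finite_subsets_card_bdd by blast
qed

section \<open>Convergence to zero of matrix powers\<close>

lemma tendsto_zero_linear_recursion:
  fixes u w :: "nat \<Rightarrow> complex"
  assumes c: "cmod c < 1" and w: "w \<longlonglongrightarrow> 0" and rec: "\<And>k. u (Suc k) = c * u k + w k"
  shows "u \<longlonglongrightarrow> 0"
proof (rule LIMSEQ_I)
  fix e :: real assume e: "0 < e"
  define r where "r = cmod c"
  have r: "0 \<le> r" "r < 1" using c by (auto simp: r_def)
  then have "0 < e * (1 - r) / 2" using e by simp
  then obtain N where N: "\<And>k. k \<ge> N \<Longrightarrow> cmod (w k) < e * (1 - r) / 2"
    using LIMSEQ_D[OF w, of "e * (1 - r) / 2"] by auto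
  \<comment> \<open>The bound survives the recursion because \<open>e / 2\<close> is the fixed point
    of the map taking \<open>t\<close> to \<open>r * t + e * (1 - r) / 2\<close>.\<close>
  have bd: "cmod (u (N + j)) \<le> r ^ j * cmod (u N) + e / 2" for j
  proof (induction j)
    case 0
    then show ?case using e by simp
  next
    case (Suc j)
    have "cmod (u (N + Suc j)) \<le> r * cmod (u (N + j)) + cmod (w (N + j))"
      by (simp add: rec r_def) (metis norm_mult norm_triangle_ineq)
    also have "\<dots> \<le> r * (r ^ j * cmod (u N) + e / 2) + e * (1 - r) / 2"
      using mult_left_mono[OF Suc r(1)] N[of "N + j"] by simp
    finally show ?case by (simp add: field_simps)
  qed
  have "(\<lambda>j. r ^ j * cmod (u N)) \<longlonglongrightarrow> 0 * cmod (u N)"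
    using r by (intro tendsto_mult LIMSEQ_power_zero tendsto_const) auto
  then obtain J where J: "\<And>j. j \<ge> J \<Longrightarrow> r ^ j * cmod (u N) < e / 2"
    using LIMSEQ_D[of _ 0 "e / 2"] e by fastforce
  have "cmod (u n) < e" if "n \<ge> N + J" for n
    using bd[of "n - N"] J[of "n - N"] that by (simp add: le_diff_conv2)
  then show "\<exists>no. \<forall>n\<ge>no. norm (u n - 0) < e" by auto
qed

lemma tendsto_matrix_vector_mult:
  fixes M :: "'a::real_normed_algebra_1 ^ 'n::finite ^ 'm::finite"
  assumes "(u \<longlongrightarrow> v) F"
  shows "((\<lambda>k. M *v u k) \<longlongrightarrow> M *v v) F"
  unfolding matrix_vector_mult_def
  by (intro tendsto_vec_lambda tendsto_sum tendsto_mult tendsto_const tendsto_vec_nth assms)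

text \<open>The \<open>n + 1\<close> vectors \<open>v\<close>, \<open>T v\<close>, ...,
  \<open>T^n v\<close> lie in an \<open>n\<close>-dimensional space, so some nontrivial combination
  vanishes. The polynomial may depend on \<open>v\<close>, which suffices for following a single
  orbit.\<close>

lemma annihilating_poly:
  fixes T :: "'a::field ^ 'n::finite \<Rightarrow> 'a ^ 'n"
  shows "\<exists>p. p \<noteq> 0 \<and> (\<Sum>i\<le>degree p. coeff p i *s (T ^^ i) v) = 0"
proof -
  define n where "n = CARD('n)"
  define t where "t i = (T ^^ i) v" for i
  \<comment> \<open>Linear dependence is a property of sets. If the iterates are distinct they form
    a set of \<open>n + 1\<close> vectors; a repetition shrinks this set, but then
    \<open>t i - t j = 0\<close> is itself the relation.\<close>
  obtain c where c: "(\<Sum>i\<le>n. c i *s t i) = 0" "\<exists>i\<le>n. c i \<noteq> 0"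
  proof (cases "inj_on t {..n}")
    case True
    have "vec.dependent (t ` {..n})"
    proof (rule vec.dependent_biggerset_general)
      show "vec.dim (t ` {..n}) < card (t ` {..n})"
        using dim_subset_UNIV_cart_gen[of "t ` {..n}"] card_image[OF True] by (simp add: n_def)
    qed
    then obtain g i where "(\<Sum>x\<in>t ` {..n}. g x *s x) = 0" "i \<le> n" "g (t i) \<noteq> 0"
      using vec.dependent_finite[of "t ` {..n}"] by auto
    then show ?thesis
      using that[of "g \<circ> t"] by (auto simp: sum.reindex[OF True])
  next
    case False
    then obtain i j where ij: "i \<le> n" "j \<le> n" "i \<noteq> j" "t i = t j"
      by (auto simp: inj_on_def)
    have "(\<Sum>l\<le>n. (if l = i then 1 else if l = j then -1 else 0) *s t l)
        = (\<Sum>l\<le>n. (if l = i then t l else 0) + (if l = j then - t l else 0))"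
      using ij(3) by (intro sum.cong) auto
    also have "\<dots> = 0"
      using ij by (simp add: sum.distrib)
    finally show ?thesis
      using that[of "\<lambda>l. if l = i then 1 else if l = j then -1 else 0"] ij(1) exI[of _ i] by simp
  qed
  define p where "p = Poly (map c [0..<Suc n])"
  have co: "coeff p i = (if i \<le> n then c i else 0)" for i
    by (auto simp: p_def nth_default_def simp del: upt_Suc)
  have "p \<noteq> 0"
    using c(2) co by (metis coeff_0)
  \<comment> \<open>Leading entries of \<open>c\<close> may vanish, so the degree can be below
    \<open>n\<close>; the extra terms are zero.\<close>
  moreover have "(\<Sum>i\<le>degree p. coeff p i *s t i) = (\<Sum>i\<le>n. c i *s t i)"
  proof -
    have dn: "degree p \<le> n" by (rule degree_le) (simp add: co)
    have "(\<Sum>i\<le>degree p. coeff p i *s t i) = (\<Sum>i\<le>n. coeff p i *s t i)"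
      using dn by (intro sum.mono_neutral_left) (auto simp: coeff_eq_0)
    then show ?thesis by (simp add: co)
  qed
  ultimately show ?thesis
    using c(1) unfolding t_def by metis
qed

lemma complex_matrix_powers_tendsto_zero:
  fixes M :: "complex ^ 'n::finite ^ 'n"
  assumes ev: "\<And>c. is_eigenvalue M c \<Longrightarrow> cmod c < 1"
  shows "p \<noteq> 0 \<Longrightarrow> (\<Sum>i\<le>degree p. coeff p i *s (((*v) M) ^^ i) v) = 0 \<Longrightarrow>
    (\<lambda>k. (((*v) M) ^^ k) v) \<longlonglongrightarrow> 0"
proof (induction "degree p" arbitrary: p v)
  case 0
  then obtain a where "p = [:a:]" "a \<noteq> 0"
    by (metis degree_eq_zeroE pCons_0_0)
  then have "v = 0" using 0 by (simp add: vec.scale_eq_0_iff)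
  moreover have "(((*v) M) ^^ k) 0 = 0" for k
    by (induction k) auto
  ultimately show ?case by simp
next
  case (Suc d)
  let ?T = "\<lambda>k. ((*v) M) ^^ k"
  have "\<not> constant (poly p)"
    using Suc.hyps(2) by (simp add: constant_degree)
  then obtain c where "poly p c = 0"
    using fundamental_theorem_of_algebra by blast
  then obtain q where q: "p = [:- c, 1:] * q"
    by (metis dvdE poly_eq_0_iff_dvd)
  then have "q \<noteq> 0" using Suc.prems by auto
  then have "degree p = degree [:- c, 1:] + degree q"
    unfolding q by (intro degree_mult_eq) auto
  then have dq: "d = degree q"
    using Suc.hyps(2) by simp
  \<comment> \<open>With \<open>p = (X - c) q\<close> and \<open>w = (M - c) v\<close>, one has
    \<open>p(M) v = q(M) w\<close>. The calculation below checks this on coefficients, so the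
    induction hypothesis applies to \<open>q\<close> and \<open>w\<close>.\<close>
  define w where "w = M *v v - c *s v"
  have Tw: "?T k w = ?T (Suc k) v - c *s ?T k v" for k
    by (induction k) (simp_all add: w_def vec.diff vec.scale)
  have cp: "coeff p i = (case i of 0 \<Rightarrow> 0 | Suc j \<Rightarrow> coeff q j) - c * coeff q i" for i
    by (simp add: q coeff_pCons split: nat.split)
  have "(\<Sum>i\<le>degree p. coeff p i *s ?T i v)
      = (\<Sum>i\<le>Suc d. (case i of 0 \<Rightarrow> 0 | Suc j \<Rightarrow> coeff q j) *s ?T i v)
        - (\<Sum>i\<le>Suc d. (c * coeff q i) *s ?T i v)"
    by (simp only: cp vec.scale_left_diff_distrib sum_subtractf Suc.hyps(2)[symmetric])
  also have "(\<Sum>i\<le>Suc d. (case i of 0 \<Rightarrow> 0 | Suc j \<Rightarrow> coeff q j) *s ?T i v)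
      = (\<Sum>i\<le>d. coeff q i *s ?T (Suc i) v)"
    by (subst sum.atMost_Suc_shift) simp
  \<comment> \<open>The top term drops out because \<open>q\<close> has degree
    \<open>d\<close>.\<close>
  also have "(\<Sum>i\<le>Suc d. (c * coeff q i) *s ?T i v) = (\<Sum>i\<le>d. (c * coeff q i) *s ?T i v)"
    by (simp add: dq coeff_eq_0)
  also have "(\<Sum>i\<le>d. coeff q i *s ?T (Suc i) v) - (\<Sum>i\<le>d. (c * coeff q i) *s ?T i v)
      = (\<Sum>i\<le>d. coeff q i *s ?T i w)"
    by (simp add: Tw vec.scale_right_diff_distrib sum_subtractf mult.commute)
  finally have "(\<Sum>i\<le>degree q. coeff q i *s ?T i w) = 0"
    using Suc.prems(2) dq by simp
  with Suc.hyps(1)[OF dq \<open>q \<noteq> 0\<close>] have w0: "(\<lambda>k. ?T k w) \<longlonglongrightarrow> 0"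
    by blast
  show ?case
  proof (cases "cmod c < 1")
    case True
    show ?thesis
    proof (rule vec_tendstoI)
      fix i
      show "(\<lambda>k. ?T k v $ i) \<longlonglongrightarrow> 0 $ i"
        using tendsto_zero_linear_recursion[OF True, of "\<lambda>k. ?T k w $ i" "\<lambda>k. ?T k v $ i"]
          tendsto_vec_nth[OF w0, of i] by (simp add: Tw)
    qed
  next
    case False
    have *: "(M - mat c) *v y = M *v y - c *s y" for y
      by (simp add: matrix_vector_mult_diff_rdistrib mat_mult_vector)
    have "\<not> is_eigenvalue M c" using ev False by blast
    then have "(M - mat c) *v y = 0 \<Longrightarrow> y = 0" for y
      by (auto simp: is_eigenvalue_def *)
    then obtain B where B: "B ** (M - mat c) = mat 1"
      using matrix_left_invertible_ker[of "M - mat c"] by blast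
    have "?T k v = B *v ?T k w" for k
    proof -
      have "?T k w = (M - mat c) *v ?T k v" by (simp add: Tw *)
      then show ?thesis by (simp add: matrix_vector_mul_assoc B)
    qed
    then show ?thesis
      using tendsto_matrix_vector_mult[OF w0, of B] by simp
  qed
qed

lemma cmod_eigenvalue_le_spec_rad:
  assumes "is_eigenvalue (\<chi> i j. complex_of_real (M $ i $ j)) c"
  shows "cmod c \<le> spec_rad M"
proof -
  have "{cmod c | c. is_eigenvalue (\<chi> i j. complex_of_real (M $ i $ j)) c}
      = cmod ` {c. is_eigenvalue (\<chi> i j. complex_of_real (M $ i $ j)) c}"
    by auto
  then show ?thesis
    unfolding spec_rad_def using assms finite_eigenvalues by (intro Max_ge) auto
qed

text \<open>Roots of the annihilating polynomial may be non-real, so the orbit is moved to complex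
  vectors. The entrywise embedding \<open>cv\<close> intertwines \<open>M\<close> with its
  complexification \<open>C\<close>, so convergence can be read back in each coordinate.\<close>

lemma matrix_powers_tendsto_zero:
  fixes M :: "real ^ 'n::finite ^ 'n"
  assumes "spec_rad M < 1"
  shows "(\<lambda>k. (((*v) M) ^^ k) v) \<longlonglongrightarrow> 0"
proof (rule vec_tendstoI)
  fix i
  define C where "C = (\<chi> i j. complex_of_real (M $ i $ j))"
  define cv where "cv = (\<lambda>y :: real ^ 'n. \<chi> i. complex_of_real (y $ i))"
  have "C *v cv y = cv (M *v y)" for y
    by (simp add: C_def cv_def matrix_vector_mult_def vec_eq_iff)
  then have pow: "(((*v) C) ^^ k) (cv v) = cv ((((*v) M) ^^ k) v)" for k
    by (induction k) simp_all
  have "cmod c < 1" if "is_eigenvalue C c" for c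
    using cmod_eigenvalue_le_spec_rad[of M c] that assms by (simp add: C_def)
  then have "(\<lambda>k. (((*v) C) ^^ k) (cv v)) \<longlonglongrightarrow> 0"
    using annihilating_poly[of "(*v) C" "cv v"] complex_matrix_powers_tendsto_zero[of C] by blast
  then have "(\<lambda>k. cv ((((*v) M) ^^ k) v) $ i) \<longlonglongrightarrow> 0 $ i"
    unfolding pow by (rule tendsto_vec_nth)
  then show "(\<lambda>k. (((*v) M) ^^ k) v $ i) \<longlonglongrightarrow> 0 $ i"
    by (simp add: cv_def tendsto_of_real_iff[where 'a=complex and c=0, simplified])
qed

section \<open>The smallest eigenvalue as a lower bound of the quadratic form\<close>

text \<open>If \<open>z = B y0\<close> were nonzero, moving from \<open>y0\<close> along
  \<open>-z\<close> would change the form by \<open>-2 s |z|^2\<close> to first order in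
  \<open>s\<close>, making it negative for small \<open>s > 0\<close>.\<close>

lemma semidefinite_kernel:
  fixes B :: "real ^ 'n::finite ^ 'n"
  assumes sym: "transpose B = B" and psd: "\<And>y. 0 \<le> y \<bullet> (B *v y)" and y0: "y0 \<bullet> (B *v y0) = 0"
  shows "B *v y0 = 0"
proof (rule ccontr)
  assume "B *v y0 \<noteq> 0"
  define z where "z = B *v y0"
  define a where "a = z \<bullet> z"
  define q where "q = z \<bullet> (B *v z)"
  \<comment> \<open>The form at \<open>y0 - s z\<close> is \<open>s * (s * q - 2 * a)\<close>, so
    \<open>s * q < a\<close> is enough; the \<open>+ 1\<close> covers \<open>q = 0\<close>.\<close>
  define s where "s = a / (q + 1)"
  have a: "a > 0" using \<open>B *v y0 \<noteq> 0\<close> by (simp add: a_def z_def)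
  have q: "q \<ge> 0" using psd by (simp add: q_def)
  have yz: "y0 \<bullet> (B *v z) = a"
    by (metis a_def z_def sym dot_lmul_matrix vector_transpose_matrix)
  have s: "s > 0" "s * q < a * 1"
    using a q by (auto simp: s_def field_simps)
  have "0 \<le> (y0 - s *\<^sub>R z) \<bullet> (B *v (y0 - s *\<^sub>R z))" by (rule psd)
  also have "\<dots> = s * (s * q - 2 * a)"
    using y0 yz by (simp add: matrix_vector_mult_diff_distrib matrix_vector_mult_scaleR
        inner_diff_left inner_diff_right z_def[symmetric] a_def[symmetric] q_def[symmetric] algebra_simps)
  also have "\<dots> < 0"
    using s a by (intro mult_pos_neg) auto
  finally show False by simp
qed

lemma lambda_min_le_quadratic_form:
  fixes W :: "real ^ 'n::finite ^ 'n"
  assumes sym: "transpose W = W"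
  shows "lambda_min W * (norm y)\<^sup>2 \<le> y \<bullet> (W *v y)"
proof -
  have cont: "continuous_on (sphere 0 1) (\<lambda>y. y \<bullet> (W *v y))"
    by (intro continuous_intros linear_continuous_on_compose[OF continuous_on_id]) simp
  have "sphere (0 :: real ^ 'n) 1 \<noteq> {}" by simp
  then obtain y0 where y0: "y0 \<in> sphere 0 1" and
    min: "\<And>y. y \<in> sphere 0 1 \<Longrightarrow> y0 \<bullet> (W *v y0) \<le> y \<bullet> (W *v y)"
    using continuous_attains_inf[OF compact_sphere _ cont] by blast
  define \<mu> where "\<mu> = y0 \<bullet> (W *v y0)"
  have ray: "\<mu> * (norm y)\<^sup>2 \<le> y \<bullet> (W *v y)" for y
  proof (cases "y = 0")
    case False
    have "\<mu> \<le> ((1 / norm y) *\<^sub>R y) \<bullet> (W *v ((1 / norm y) *\<^sub>R y))"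
      unfolding \<mu>_def using False by (intro min) simp
    then show ?thesis
      using False by (simp add: matrix_vector_mult_scaleR power2_eq_square field_simps)
  qed simp
  \<comment> \<open>The shifted form is nonnegative everywhere and zero at \<open>y0\<close>, so
    \<open>semidefinite_kernel\<close> yields the eigenvector equation without differentiating along
    the sphere.\<close>
  define B where "B = W - mat \<mu>"
  have B: "B *v y = W *v y - \<mu> *\<^sub>R y" for y
    by (simp add: B_def matrix_vector_mult_diff_rdistrib mat_mult_vector scalar_mult_eq_scaleR)
  have "B *v y0 = 0"
  proof (rule semidefinite_kernel)
    show "transpose B = B"
      using sym by (simp add: B_def transpose_def mat_def vec_eq_iff)
    show "0 \<le> y \<bullet> (B *v y)" for y
      using ray[of y] by (simp add: B inner_diff_right power2_norm_eq_inner)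
    show "y0 \<bullet> (B *v y0) = 0"
      using y0 by (simp add: B inner_diff_right \<mu>_def[symmetric] dot_square_norm)
  qed
  then have "W *v y0 = \<mu> *s y0"
    by (simp add: B scalar_mult_eq_scaleR)
  moreover have "y0 \<noteq> 0" using y0 by auto
  ultimately have "is_eigenvalue W \<mu>"
    by (auto simp: is_eigenvalue_def)
  then have "lambda_min W \<le> \<mu>"
    unfolding lambda_min_def using finite_eigenvalues by (intro Min_le) auto
  then show ?thesis
    using ray[of y] mult_right_mono[of "lambda_min W" \<mu> "(norm y)\<^sup>2"] by simp
qed

section \<open>Averaging over the next random index\<close>

text \<open>The history \<open>H\<close> of the first \<open>k\<close> indices takes finitely many
  values, so every function of \<open>H\<close> and \<open>I k\<close> is a finite sum of
  indicators. Independence factors the probability of each joint value; this replaces conditional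
  expectation and lets \<open>F\<close> be arbitrary.\<close>

lemma (in prob_space) expectation_next_index:
  fixes I :: "nat \<Rightarrow> 'a \<Rightarrow> 'm::finite"
    and k :: nat
    and F :: "(nat \<Rightarrow> 'm) \<Rightarrow> 'm \<Rightarrow> 'b::{banach, second_countable_topology}"
  assumes indep: "indep_vars (\<lambda>_. count_space UNIV) I UNIV"
  defines "H \<equiv> \<lambda>w. restrict (\<lambda>j. I j w) {..<k}"
  shows "integrable M (\<lambda>w. F (H w) (I k w))"
    and "expectation (\<lambda>w. F (H w) (I k w))
      = (\<Sum>i\<in>UNIV. prob {w \<in> space M. I k w = i} *\<^sub>R expectation (\<lambda>w. F (H w) i))"
proof -
  define P where "P = PiE {..<k} (\<lambda>_. UNIV :: 'm set)"
  have finP: "finite P" by (simp add: P_def finite_PiE)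
  have HP: "H w \<in> P" for w by (simp add: P_def H_def)
  \<comment> \<open>\<open>indep_var_restrict\<close> speaks of subfamilies, so the single index
    \<open>I k\<close> is packaged as a function on \<open>{k}\<close>; \<open>K_eq\<close>
    translates back.\<close>
  define K where "K w = restrict (\<lambda>j. I j w) {k}" for w
  define Q where "Q = PiE {k} (\<lambda>_. UNIV :: 'm set)"
  have "indep_var (PiM {..<k} (\<lambda>_. count_space UNIV)) H (PiM {k} (\<lambda>_. count_space UNIV)) K"
    unfolding H_def K_def by (rule indep_var_restrict[OF indep]) auto
  \<comment> \<open>A finite product of discrete spaces on a finite type is discrete, which makes
    single histories measurable.\<close>
  then have iv: "indep_var (count_space P) H (count_space Q) K"
    by (simp add: P_def Q_def count_space_PiM_finite)
  have K_eq: "K w = (\<lambda>j\<in>{k}. i) \<longleftrightarrow> I k w = i" for w i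
    unfolding K_def by (auto intro: restrict_ext dest: fun_cong[of _ _ k])
  have H: "H \<in> measurable M (count_space P)"
    using iv unfolding indep_var_eq by auto
  have I: "I k \<in> measurable M (count_space UNIV)"
    using indep unfolding indep_vars_def by auto
  define E1 where "E1 h = {w \<in> space M. H w = h}" for h
  define E2 where "E2 i = {w \<in> space M. I k w = i}" for i
  have E1: "E1 h \<in> events" if "h \<in> P" for h
    using measurable_sets[OF H, of "{h}"] that
    by (simp add: E1_def vimage_def Int_def conj_commute)
  have E2: "E2 i \<in> events" for i
    using measurable_sets[OF I, of "{i}"] by (simp add: E2_def vimage_def Int_def conj_commute)
  have prod: "prob (E1 h \<inter> E2 i) = prob (E1 h) * prob (E2 i)" if "h \<in> P" for h i
  proof -
    have "(\<lambda>w. (H w, K w)) -` ({h} \<times> {\<lambda>j\<in>{k}. i}) \<inter> space M = E1 h \<inter> E2 i"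
      "H -` {h} \<inter> space M = E1 h" "K -` {\<lambda>j\<in>{k}. i} \<inter> space M = E2 i"
      by (auto simp: E1_def E2_def K_eq)
    then show ?thesis
      using indep_varD[OF iv, of "{h}" "{\<lambda>j\<in>{k}. i}"] that by (simp add: Q_def)
  qed
  \<comment> \<open>Only the pair \<open>h = H w\<close>, \<open>i = I k w\<close>
    contributes.\<close>
  have F_sum: "F (H w) (I k w) = (\<Sum>h\<in>P. \<Sum>i\<in>UNIV. indicator (E1 h \<inter> E2 i) w *\<^sub>R F h i)"
    if "w \<in> space M" for w
  proof -
    have "(\<Sum>h\<in>P. \<Sum>i\<in>UNIV. indicator (E1 h \<inter> E2 i) w *\<^sub>R F h i)
        = (\<Sum>h\<in>P. if h = H w then (\<Sum>i\<in>UNIV. if i = I k w then F h i else 0) else 0)"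
      using that by (intro sum.cong) (auto simp: E1_def E2_def intro!: sum.cong sum.neutral)
    then show ?thesis
      using finP HP by simp
  qed
  have F_sum': "F (H w) i = (\<Sum>h\<in>P. indicator (E1 h) w *\<^sub>R F h i)" if "w \<in> space M" for w i
  proof -
    have "(\<Sum>h\<in>P. indicator (E1 h) w *\<^sub>R F h i) = (\<Sum>h\<in>P. if h = H w then F h i else 0)"
      using that by (intro sum.cong) (auto simp: E1_def)
    then show ?thesis
      using finP HP by simp
  qed
  have intg: "integrable M (\<lambda>w. indicator X w *\<^sub>R y)" if "X \<in> events" for X and y :: 'b
    using that by (intro integrable_scaleR_left integrable_real_indicator) (auto simp: emeasure_eq_measure)
  have expg: "expectation (\<lambda>w. indicator X w *\<^sub>R y) = prob X *\<^sub>R y"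
    if "X \<in> events" for X and y :: 'b
    using that by (subst integral_scaleR_left) (auto simp: emeasure_eq_measure)
  show "integrable M (\<lambda>w. F (H w) (I k w))"
    by (subst Bochner_Integration.integrable_cong[OF refl F_sum], assumption)
       (intro Bochner_Integration.integrable_sum intg sets.Int E1 E2)
  have "expectation (\<lambda>w. F (H w) (I k w))
      = expectation (\<lambda>w. \<Sum>h\<in>P. \<Sum>i\<in>UNIV. indicator (E1 h \<inter> E2 i) w *\<^sub>R F h i)"
    by (intro Bochner_Integration.integral_cong refl F_sum)
  also have "\<dots> = (\<Sum>h\<in>P. \<Sum>i\<in>UNIV. expectation (\<lambda>w. indicator (E1 h \<inter> E2 i) w *\<^sub>R F h i))"
    by (simp only: Bochner_Integration.integral_sum Bochner_Integration.integrable_sum intg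
        sets.Int E1 E2 cong: sum.cong)
  also have "\<dots> = (\<Sum>h\<in>P. \<Sum>i\<in>UNIV. (prob (E1 h) * prob (E2 i)) *\<^sub>R F h i)"
    by (intro sum.cong refl) (simp add: expg prod E1 E2 sets.Int)
  also have "\<dots> = (\<Sum>i\<in>UNIV. \<Sum>h\<in>P. prob (E2 i) *\<^sub>R prob (E1 h) *\<^sub>R F h i)"
    by (subst sum.swap) (simp add: mult.commute)
  \<comment> \<open>For fixed \<open>i\<close>, the sum over histories is folded back into an
    expectation by \<open>F_sum'\<close>.\<close>
  also have "\<dots> = (\<Sum>i\<in>UNIV. prob (E2 i) *\<^sub>R expectation (\<lambda>w. F (H w) i))"
  proof (intro sum.cong refl)
    fix i
    have "expectation (\<lambda>w. F (H w) i) = expectation (\<lambda>w. \<Sum>h\<in>P. indicator (E1 h) w *\<^sub>R F h i)"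
      by (intro Bochner_Integration.integral_cong refl F_sum')
    also have "\<dots> = (\<Sum>h\<in>P. expectation (\<lambda>w. indicator (E1 h) w *\<^sub>R F h i))"
      by (intro Bochner_Integration.integral_sum intg E1)
    also have "\<dots> = (\<Sum>h\<in>P. prob (E1 h) *\<^sub>R F h i)"
      by (intro sum.cong refl expg E1)
    finally show "(\<Sum>h\<in>P. prob (E2 i) *\<^sub>R prob (E1 h) *\<^sub>R F h i)
        = prob (E2 i) *\<^sub>R expectation (\<lambda>w. F (H w) i)"
      by (simp only: scaleR_sum_right)
  qed
  finally show "expectation (\<lambda>w. F (H w) (I k w))
      = (\<Sum>i\<in>UNIV. prob {w \<in> space M. I k w = i} *\<^sub>R expectation (\<lambda>w. F (H w) i))"
    by (simp add: E2_def)
qed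

section \<open>The error recursion and its expectation\<close>

text \<open>Step \<open>k\<close> itself uses index \<open>k\<close>, so the iterate number
  \<open>k\<close> sees only earlier indices. This makes the error a function of the history
  \<open>H\<close>.\<close>

lemma rkma_cong:
  "(\<And>j. j < k \<Longrightarrow> idx j = idx' j) \<Longrightarrow> rkma A V b x0 idx k = rkma A V b x0 idx' k"
  by (induction k) simp_all

text \<open>When the denominator is nonzero, this is the generally oblique projection along
  \<open>V $ i\<close> onto the hyperplane orthogonal to \<open>A $ i\<close>.\<close>

definition error_step ::
  "real ^ 'n::finite ^ 'm::finite \<Rightarrow> real ^ 'n ^ 'm \<Rightarrow> real ^ 'n \<Rightarrow> 'm \<Rightarrow> real ^ 'n" where
  "error_step A V y i = y - ((A $ i \<bullet> y) / (A $ i \<bullet> V $ i)) *\<^sub>R V $ i"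

lemma rkma_error_Suc:
  assumes "A *v xhat = b"
  shows "rkma A V b x0 idx (Suc k) - xhat = error_step A V (rkma A V b x0 idx k - xhat) (idx k)"
proof -
  have "b $ i = A $ i \<bullet> xhat" for i
    by (simp add: assms[symmetric] matrix_vector_mul_component)
  then show ?thesis
    by (simp add: error_step_def inner_diff_right)
qed

text \<open>The test function \<open>\<phi>\<close> serves both parts of the theorem: the identity
  gives the mean, the squared norm the second moment.\<close>

lemma (in prob_space) rkma_error_expectation:
  fixes A V :: "real ^ 'n::finite ^ 'm::finite"
    and x0 :: "real ^ 'n"
    and \<phi> :: "real ^ 'n \<Rightarrow> 'b::{banach, second_countable_topology}"
  assumes indep: "indep_vars (\<lambda>_. count_space UNIV) I UNIV"
    and p: "\<And>i. prob {w \<in> space M. I k w = i} = p i"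
    and cons: "A *v xhat = b"
  defines "e \<equiv> \<lambda>k w. rkma A V b x0 (\<lambda>j. I j w) k - xhat"
  shows "integrable M (\<lambda>w. \<phi> (e k w))"
    and "expectation (\<lambda>w. \<phi> (e (Suc k) w))
      = expectation (\<lambda>w. \<Sum>i\<in>UNIV. p i *\<^sub>R \<phi> (error_step A V (e k w) i))"
proof -
  define H where "H w = restrict (\<lambda>j. I j w) {..<k}" for w
  define G where "G h = rkma A V b x0 h k - xhat" for h
  have e: "e k w = G (H w)" for w
    unfolding e_def G_def H_def by (intro arg_cong2[where f="(-)"] refl rkma_cong) simp
  \<comment> \<open>General \<open>\<psi>\<close> is needed, since the last step uses
    \<open>\<phi>\<close> composed with \<open>error_step\<close>.\<close>
  have int: "integrable M (\<lambda>w. \<psi> (e k w))" for \<psi> :: "real ^ 'n \<Rightarrow> 'b"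
    using expectation_next_index(1)[OF indep, of "\<lambda>h i. \<psi> (G h)" k] by (simp add: e H_def)
  then show "integrable M (\<lambda>w. \<phi> (e k w))" .
  have "expectation (\<lambda>w. \<phi> (e (Suc k) w)) = expectation (\<lambda>w. \<phi> (error_step A V (e k w) (I k w)))"
    by (simp only: e_def rkma_error_Suc[OF cons])
  also have "\<dots> = (\<Sum>i\<in>UNIV. p i *\<^sub>R expectation (\<lambda>w. \<phi> (error_step A V (e k w) i)))"
    using expectation_next_index(2)[OF indep, of "\<lambda>h i. \<phi> (error_step A V (G h) i)" k]
    by (simp add: e H_def p)
  also have "\<dots> = expectation (\<lambda>w. \<Sum>i\<in>UNIV. p i *\<^sub>R \<phi> (error_step A V (e k w) i))"
    using int by (subst Bochner_Integration.integral_sum) auto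
  finally show "expectation (\<lambda>w. \<phi> (e (Suc k) w))
      = expectation (\<lambda>w. \<Sum>i\<in>UNIV. p i *\<^sub>R \<phi> (error_step A V (e k w) i))" .
qed

section \<open>Mean and mean square of one step in matrix form\<close>

text \<open>The product is a weighted sum of rank-one matrices built from matching rows. This links
  the matrices of the theorem to averages over the index \<open>i\<close>.\<close>

lemma transpose_diag_matrix_mult_vector:
  fixes A B :: "real ^ 'n::finite ^ 'm::finite"
  shows "(transpose A ** diag_matrix d ** B) *v y = (\<Sum>i\<in>UNIV. (d i * (B $ i \<bullet> y)) *\<^sub>R A $ i)"
proof -
  have d: "diag_matrix d *v z = (\<chi> i. d i * z $ i)" for z
    by (simp add: diag_matrix_def matrix_vector_mult_def vec_eq_iff if_distrib[of "\<lambda>a. a * b" for b]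
        cong: if_cong)
  have "(transpose A ** diag_matrix d ** B) *v y = transpose A *v (\<chi> i. d i * (B $ i \<bullet> y))"
    by (simp add: matrix_vector_mul_assoc[symmetric] d matrix_vector_mul_component)
  then show ?thesis
    by (simp add: vec_eq_iff matrix_vector_mult_def transpose_def mult.commute)
qed

lemma diag_matrix_mult: "diag_matrix c ** diag_matrix d = (diag_matrix (\<lambda>i. c i * d i) :: real ^ 'm::finite ^ 'm)"
  by (simp add: diag_matrix_def matrix_matrix_mult_def vec_eq_iff if_distrib[of "\<lambda>a. a * b" for b]
        cong: if_cong)

lemma transpose_diag_matrix [simp]: "transpose (diag_matrix d) = diag_matrix d"
  by (auto simp: diag_matrix_def transpose_def vec_eq_iff)

lemma transpose_diff: "transpose (A - B) = transpose A - transpose (B :: 'a::ab_group_add ^ 'n ^ 'm)"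
  by (simp add: transpose_def vec_eq_iff)

lemma transpose_add: "transpose (A + B) = transpose A + transpose (B :: 'a::ab_group_add ^ 'n ^ 'm)"
  by (simp add: transpose_def vec_eq_iff)

lemma error_step_mean:
  fixes A V :: "real ^ 'n::finite ^ 'm::finite"
  assumes "(\<Sum>i\<in>UNIV. p i) = 1"
  defines "D \<equiv> diag_matrix (\<lambda>i. p i / (A $ i \<bullet> V $ i))"
  shows "(\<Sum>i\<in>UNIV. p i *\<^sub>R error_step A V y i) = (mat 1 - transpose V ** D ** A) *v y"
  using assms(1)
  by (simp add: error_step_def D_def matrix_vector_mult_diff_rdistrib transpose_diag_matrix_mult_vector
      scaleR_diff_right sum_subtractf scaleR_sum_left[symmetric])

lemma error_step_mean_square:
  fixes A V :: "real ^ 'n::finite ^ 'm::finite"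
  assumes "(\<Sum>i\<in>UNIV. p i) = 1"
  defines "D \<equiv> diag_matrix (\<lambda>i. p i / (A $ i \<bullet> V $ i))"
    and "S \<equiv> diag_matrix (\<lambda>i. (norm (V $ i))\<^sup>2 / (A $ i \<bullet> V $ i))"
  shows "(\<Sum>i\<in>UNIV. p i *\<^sub>R (norm (error_step A V y i))\<^sup>2) = (norm y)\<^sup>2
    - y \<bullet> ((transpose V ** D ** A + transpose A ** D ** V - transpose A ** S ** D ** A) *v y)"
proof -
  define q where "q i = A $ i \<bullet> V $ i" for i
  have nrm: "(norm (error_step A V y i))\<^sup>2 = (norm y)\<^sup>2 - 2 * (A $ i \<bullet> y) * (V $ i \<bullet> y) / q i
      + (norm (V $ i))\<^sup>2 * (A $ i \<bullet> y)\<^sup>2 / (q i)\<^sup>2" for i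
    unfolding power2_norm_eq_inner error_step_def q_def[symmetric]
    by (simp add: inner_diff_left inner_diff_right inner_commute power2_eq_square algebra_simps)
  \<comment> \<open>The product \<open>S ** D\<close> has entries
    \<open>(norm (V $ i))\<^sup>2 * p i / (q i)\<^sup>2\<close>, exactly the weights of the
    quadratic term in \<open>nrm\<close>.\<close>
  have SD: "transpose A ** S ** D ** A
      = transpose A ** diag_matrix (\<lambda>i. ((norm (V $ i))\<^sup>2 / q i) * (p i / q i)) ** A"
    unfolding S_def D_def q_def diag_matrix_mult[symmetric] by (simp only: matrix_mul_assoc)
  \<comment> \<open>The first two summands are transposes of each other and give the same quadratic
    form; together they account for the factor 2 of the cross term.\<close>
  have "y \<bullet> ((transpose V ** D ** A + transpose A ** D ** V - transpose A ** S ** D ** A) *v y)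
    = (\<Sum>i\<in>UNIV. p i * (A $ i \<bullet> y) * (V $ i \<bullet> y) / q i) + (\<Sum>i\<in>UNIV. p i * (A $ i \<bullet> y) * (V $ i \<bullet> y) / q i)
      - (\<Sum>i\<in>UNIV. p i * ((norm (V $ i))\<^sup>2 * (A $ i \<bullet> y)\<^sup>2 / (q i)\<^sup>2))"
    unfolding SD unfolding D_def q_def[symmetric]
    by (simp add: matrix_vector_mult_diff_rdistrib matrix_vector_mult_add_rdistrib
        transpose_diag_matrix_mult_vector inner_diff_right inner_add_right inner_sum_right
        inner_commute power2_eq_square mult_ac)
  moreover have "(\<Sum>i\<in>UNIV. p i *\<^sub>R (norm (error_step A V y i))\<^sup>2)
      = (\<Sum>i\<in>UNIV. p i * (norm y)\<^sup>2 - 2 * (p i * (A $ i \<bullet> y) * (V $ i \<bullet> y) / q i)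
      + p i * ((norm (V $ i))\<^sup>2 * (A $ i \<bullet> y)\<^sup>2 / (q i)\<^sup>2))"
    by (simp add: nrm algebra_simps)
  moreover have "(\<Sum>i\<in>UNIV. p i * (norm y)\<^sup>2) = (norm y)\<^sup>2"
    using assms(1) by (simp add: sum_distrib_right[symmetric])
  ultimately show ?thesis
    by (simp only: sum.distrib sum_subtractf sum_distrib_left[symmetric])
qed

section \<open>Convergence of the mean and decay of the mean square\<close>

theorem theorem2p2:
  fixes A V :: "real ^ 'n::finite ^ 'm::finite"
    and b :: "real ^ 'm"
    and xhat x0 :: "real ^ 'n"
    and p :: "'m \<Rightarrow> real"
    and D S :: "real ^ 'm ^ 'm"
    and lam :: real
    and M :: "'w measure"
    and I :: "nat \<Rightarrow> 'w \<Rightarrow> 'm"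
    and x :: "nat \<Rightarrow> 'w \<Rightarrow> real ^ 'n"
  assumes "CARD('m) \<ge> CARD('n)"
    and "\<And>i. A $ i \<bullet> V $ i > 0"
    and "\<And>i. p i > 0"
    and "(\<Sum>i\<in>UNIV. p i) = 1"
    and "A *v xhat = b"
    and "D = diag_matrix (\<lambda>i. p i / (A $ i \<bullet> V $ i))"
    and "S = diag_matrix (\<lambda>i. (norm (V $ i))\<^sup>2 / (A $ i \<bullet> V $ i))"
    and "lam = lambda_min (transpose V ** D ** A + transpose A ** D ** V
                           - transpose A ** S ** D ** A)"
    and "prob_space M"
    and "prob_space.indep_vars M (\<lambda>_. count_space UNIV) I UNIV"
    and "\<And>k i. measure M {w \<in> space M. I k w = i} = p i"
    and "\<And>k w. x k w = rkma A V b x0 (\<lambda>j. I j w) k"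
  shows "(spec_rad (mat 1 - transpose V ** D ** A) < 1 \<longrightarrow>
            (\<lambda>k. integral\<^sup>L M (\<lambda>w. x k w - xhat)) \<longlonglongrightarrow> 0 \<and>
            (\<forall>k. norm (integral\<^sup>L M (\<lambda>w. x k w - xhat))
               \<le> onorm (\<lambda>y. (mat 1 - transpose V ** D ** A) *v y) ^ k * norm (x0 - xhat)))
       \<and> (lam > 0 \<longrightarrow>
            (\<forall>k. integral\<^sup>L M (\<lambda>w. (norm (x (Suc k) w - xhat))\<^sup>2)
               \<le> (1 - lam) * integral\<^sup>L M (\<lambda>w. (norm (x k w - xhat))\<^sup>2)))"
proof -
  interpret prob_space M by fact
  define R where "R = mat 1 - transpose V ** D ** A"
  define W where "W = transpose V ** D ** A + transpose A ** D ** V - transpose A ** S ** D ** A"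
  define e where "e k w = x k w - xhat" for k w
  have e: "e k w = rkma A V b x0 (\<lambda>j. I j w) k - xhat" for k w
    by (simp add: e_def assms(12))
  note expectation_step = rkma_error_expectation[OF assms(10,11,5), where V = V and ?x0.0 = x0, folded e]
  have int: "integrable M (e k)" for k
    by (rule expectation_step(1))
  have int2: "integrable M (\<lambda>w. f (e k w))" for f :: "real ^ 'n \<Rightarrow> real" and k
    by (rule expectation_step(1))
  have mean_Suc: "expectation (e (Suc k)) = R *v expectation (e k)" for k
  proof -
    have "expectation (e (Suc k)) = expectation (\<lambda>w. R *v e k w)"
      by (simp add: expectation_step(2)[where \<phi> = "\<lambda>y. y"] error_step_mean[OF assms(4)]
          R_def assms(6))
    \<comment> \<open>Expectation commutes with bounded linear maps.\<close>
    also have "\<dots> = R *v expectation (e k)"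
      using int by (intro integral_bounded_linear) simp_all
    finally show ?thesis .
  qed
  have e0: "e 0 = (\<lambda>w. x0 - xhat)"
    by (simp add: e fun_eq_iff)
  have mean: "expectation (e k) = (((*v) R) ^^ k) (x0 - xhat)" for k
    by (induction k) (simp_all add: mean_Suc e0 prob_space)
  have mean_bound: "norm (expectation (e k)) \<le> onorm (\<lambda>y. R *v y) ^ k * norm (x0 - xhat)" for k
  proof (induction k)
    case (Suc k)
    have "norm (expectation (e (Suc k))) \<le> onorm (\<lambda>y. R *v y) * norm (expectation (e k))"
      unfolding mean_Suc by (rule onorm) simp
    also have "\<dots> \<le> onorm (\<lambda>y. R *v y) * (onorm (\<lambda>y. R *v y) ^ k * norm (x0 - xhat))"
      by (intro mult_left_mono Suc onorm_pos_le) simp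
    finally show ?case by (simp add: mult.assoc)
  qed (simp add: e0 prob_space)
  have square_Suc: "expectation (\<lambda>w. (norm (e (Suc k) w))\<^sup>2)
      \<le> (1 - lam) * expectation (\<lambda>w. (norm (e k w))\<^sup>2)" for k
  proof -
    \<comment> \<open>Transposition swaps the first two summands of \<open>W\<close> and turns
      \<open>S ** D\<close> into \<open>D ** S\<close>, which is the same because diagonal matrices
      commute.\<close>
    have "transpose W = W"
      by (simp add: W_def transpose_add transpose_diff matrix_transpose_mul matrix_mul_assoc
          assms(6,7))
         (simp add: matrix_mul_assoc[symmetric] diag_matrix_mult mult.commute add.commute)
    then have W: "lam * (norm y)\<^sup>2 \<le> y \<bullet> (W *v y)" for y
      using lambda_min_le_quadratic_form[of W y] by (simp add: assms(8) W_def)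
    have "expectation (\<lambda>w. (norm (e (Suc k) w))\<^sup>2)
        = expectation (\<lambda>w. (norm (e k w))\<^sup>2 - e k w \<bullet> (W *v e k w))"
      by (simp add: expectation_step(2)[where \<phi> = "\<lambda>y. (norm y)\<^sup>2"]
          error_step_mean_square[OF assms(4)] W_def assms(6,7) del: real_scaleR_def)
    also have "\<dots> \<le> expectation (\<lambda>w. (1 - lam) * (norm (e k w))\<^sup>2)"
      using W by (intro integral_mono int2) (simp add: algebra_simps)
    finally show ?thesis by simp
  qed
  have "spec_rad R < 1 \<Longrightarrow> (\<lambda>k. expectation (e k)) \<longlonglongrightarrow> 0"
    unfolding mean by (rule matrix_powers_tendsto_zero)
  then show ?thesis
    using mean_bound square_Suc by (auto simp: e_def[abs_def] R_def)
qed

end
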